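(* Let $k\ge 3$ and $n$ be positive integers. For every $k$-uniform hypergraph $G$ with $n$ vertices and nonempty hyperedge set, the tensor entropy satisfies $S(G)\le \ln n$; and if $G$ is $1$-regular, then this maximum value is attained, i.e. $S(G)=\ln n$.
   Context: A $k$-uniform hypergraph $G=(V,E)$ with $n$ vertices has $V=\{1,\dots,n\}$ and $E$ a set of $k$-element subsets of $V$ (the hyperedges). $G$ is $d$-regular if every vertex is contained in exactly $d$ hyperedges. Its adjacency tensor $A\in\mathbb{R}^{n\times\cdots\times n}$ (order $k$) has entries $A_{j_1\dots j_k}=\frac{1}{(k-1)!}$ if $j_1,\dots,j_k$ are distinct and $\{j_1,\dots,j_k\}\in E$, and $0$ otherwise. Its degree tensor $D$ (order $k$, dimension $n$) is diagonal, with $D_{jj\dots j}$ equal to the number of hyperedges containing vertex $j$ and all other entries $0$. The Laplacian tensor is $L=D-A$. The $k$-mode unfolding $L_{(k)}\in\mathbb{R}^{n\times n^{k-1}}$ is the matrix whose rows are indexed by $j_k$ and columns by $(j_1,\dots,j_{k-1})$, with entry $L_{j_1\dots j_k}$ (since $L$ is invariant under permutations of its indices, unfolding along any mode gives the same matrix). The $k$-mode singular values $\gamma_1,\dots,\gamma_n\ge 0$ of $L$ are the $n$ singular values of $L_{(k)}$, i.e. the square roots of the eigenvalues of $L_{(k)}L_{(k)}^\top\in\mathbb{R}^{n\times n}$, counted with multiplicity. For $E\neq\emptyset$, the tensor entropy of $G$ is $S(G)=-\sum_{j=1}^n\hat\gamma_j\ln\hat\gamma_j$, where $\hat\gamma_j=\gamma_j/\sum_{i=1}^n\gamma_i$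 and $0\ln 0=0$. *)

theory Defs
  imports Complex_Main "HOL-Computational_Algebra.Computational_Algebra"
    "Jordan_Normal_Form.Char_Poly"
begin

type_synonym hyperedges = "nat set set"

definition uniform_hypergraph :: "nat \<Rightarrow> nat \<Rightarrow> hyperedges \<Rightarrow> bool" where
  "uniform_hypergraph k n E \<longleftrightarrow> (\<forall>e\<in>E. e \<subseteq> {1..n} \<and> card e = k)"

definition vertex_degree :: "hyperedges \<Rightarrow> nat \<Rightarrow> nat" where
  "vertex_degree E v = card {e \<in> E. v \<in> e}"

definition regular_hypergraph :: "nat \<Rightarrow> hyperedges \<Rightarrow> nat \<Rightarrow> bool" where
  "regular_hypergraph n E d \<longleftrightarrow> (\<forall>v\<in>{1..n}. vertex_degree E v = d)"

(* An order-k tensor of dimension n is a function on index lists; only its values on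
   lists [j_1, ..., j_k] of length k with entries in {1..n} are meaningful. *)
type_synonym tensor = "nat list \<Rightarrow> real"

definition adjacency_tensor :: "nat \<Rightarrow> hyperedges \<Rightarrow> tensor" where
  "adjacency_tensor k E js = (if distinct js \<and> set js \<in> E then 1 / fact (k - 1) else 0)"

definition degree_tensor :: "nat \<Rightarrow> hyperedges \<Rightarrow> tensor" where
  "degree_tensor k E js = (if js = replicate k (hd js) then real (vertex_degree E (hd js)) else 0)"

definition laplacian_tensor :: "nat \<Rightarrow> hyperedges \<Rightarrow> tensor" where
  "laplacian_tensor k E js = degree_tensor k E js - adjacency_tensor k E js"

(* Matrix rows and columns are numbered from 0, vertices from 1.  Row i stands for
   j_k = i + 1; column c stands for the tuple (j_1, ..., j_(k-1)) in which j_(m+1) - 1 is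
   the base-n digit of c of weight n^m.  This enumerates each tuple exactly once. *)
definition mode_unfolding :: "nat \<Rightarrow> nat \<Rightarrow> tensor \<Rightarrow> real mat" where
  "mode_unfolding k n T =
     mat n (n ^ (k - 1)) (\<lambda>(i, c). T (map (\<lambda>m. c div n ^ m mod n + 1) [0..<k - 1] @ [i + 1]))"

(* The real roots of the characteristic polynomial, with multiplicity, are all the
   eigenvalues, because M M^T is a real symmetric matrix. *)
definition singular_values :: "real mat \<Rightarrow> real multiset" where
  "singular_values M = image_mset sqrt (proots (char_poly (M * transpose_mat M)))"

definition mode_singular_values :: "nat \<Rightarrow> nat \<Rightarrow> tensor \<Rightarrow> real multiset" where
  "mode_singular_values k n T = singular_values (mode_unfolding k n T)"

(* The convention 0 ln 0 = 0 holds since multiplication by 0 yields 0. *)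
definition tensor_entropy :: "nat \<Rightarrow> nat \<Rightarrow> hyperedges \<Rightarrow> real" where
  "tensor_entropy k n E =
     (let \<gamma>s = mode_singular_values k n (laplacian_tensor k E);
          s = sum_mset \<gamma>s
      in - (\<Sum>\<gamma>\<in>#\<gamma>s. \<gamma> / s * ln (\<gamma> / s)))"

end

(* The upper bound is Gibbs' inequality: the normalised singular values are nonnegative,
   there are at most n of them, and they sum to 1 unless all vanish.

   For a 1-regular hypergraph, the slice of the Laplacian tensor with last index v is
   supported on the constant tuple (v, ..., v) and on the orderings of e - {v}, where e is
   the unique hyperedge through v.  These supports are disjoint for distinct v, because a
   common ordering would be a tuple of vertices of both hyperedges.  So L_(k) L_(k)^T is
   diagonal, each diagonal entry being 1 + (k-1)! / (k-1)!^2, and all singular values agree. *)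
theory Submission
  imports Defs "HOL-Combinatorics.Multiset_Permutations"
begin

section \<open>Entropy of a multiset of weights\<close>

text \<open>The tangent bound \<open>ln x <= x - 1\<close> at \<open>x = 1 / (n * p)\<close>, scaled
  by \<open>p\<close>. The correction \<open>1 / n - p\<close> is kept because it sums to at most 0
  over at most \<open>n\<close> weights of total 1.\<close>

lemma neg_mult_ln_le:
  fixes p :: real and n :: nat
  assumes "p \<ge> 0" and "n > 0"
  shows "- (p * ln p) \<le> p * ln n + (1 / n - p)"
proof (cases "p = 0")
  case False
  with assms have p: "p > 0" by simp
  have "p * ln (1 / (n * p)) \<le> p * (1 / (n * p) - 1)"
    using p assms by (intro mult_left_mono ln_le_minus_one) auto
  also have "\<dots> = 1 / n - p"
    using p by (simp add: field_simps)
  also have "p * ln (1 / (n * p)) = - (p * ln n) - p * ln p"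
    using p assms by (simp add: ln_div ln_mult algebra_simps)
  finally show ?thesis by simp
qed simp

lemma sum_mset_entropy_le:
  fixes W :: "real multiset"
  assumes nonneg: "\<And>w. w \<in># W \<Longrightarrow> w \<ge> 0" and "size W \<le> n" and "n > 0"
  shows "- (\<Sum>w\<in>#W. w / sum_mset W * ln (w / sum_mset W)) \<le> ln n"
\<comment> \<open>With total 0 every quotient is 0 by the convention for division, so the entropy is
  0, and \<open>ln n\<close> is nonnegative.\<close>
proof (cases "sum_mset W = 0")
  case True
  then show ?thesis using assms by simp
next
  case False
  define s where "s = sum_mset W"
  have "s \<ge> 0"
    unfolding s_def using nonneg by (induction W) auto
  with False have s: "s > 0" by (simp add: s_def)
  have total: "(\<Sum>w\<in>#W. w / s) = 1"
  proof -
    have "(\<Sum>w\<in>#W. w / s) = sum_mset W / s"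
      by (induction W) (auto simp: add_divide_distrib)
    with s show ?thesis by (simp add: s_def)
  qed
  have "- (\<Sum>w\<in>#W. w / s * ln (w / s)) = (\<Sum>w\<in>#W. - (w / s * ln (w / s)))"
    by (induction W) auto
  also have "\<dots> \<le> (\<Sum>w\<in>#W. w / s * ln n + (1 / n - w / s))"
    using nonneg s assms by (intro sum_mset_mono neg_mult_ln_le) auto
  also have "\<dots> = (\<Sum>w\<in>#W. w / s) * ln n + size W / n - (\<Sum>w\<in>#W. w / s)"
    by (induction W) (auto simp: algebra_simps add_divide_distrib)
  \<comment> \<open>The corrections add up to \<open>size W / n - 1\<close>, which is at most
    0.\<close>
  also have "\<dots> \<le> ln n"
    using assms by (simp add: total field_simps)
  finally show ?thesis by (simp add: s_def)
qed

lemma sum_mset_entropy_replicate: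
  fixes w :: real
  assumes "w \<noteq> 0" and "n > 0"
  shows "- (\<Sum>x\<in>#replicate_mset n w. x / sum_mset (replicate_mset n w) *
           ln (x / sum_mset (replicate_mset n w))) = ln n"
proof -
  have "w / (real n * w) = 1 / n" using assms by simp
  moreover have "ln (1 / real n) = - ln n" using assms by (simp add: ln_div)
  ultimately have "ln (w / (real n * w)) = - ln n" by (simp only:)
  with assms show ?thesis by simp
qed

section \<open>Singular values\<close>

text \<open>For an eigenvector \<open>v\<close>, moving \<open>M\<close> across the scalar product
  turns \<open>x * (v \<bullet> v)\<close> into the squared norm of
  \<open>transpose_mat M *\<^sub>v v\<close>.\<close>

lemma eigenvalue_gram_nonneg:
  fixes M :: "real mat"
  assumes M: "M \<in> carrier_mat r c" and ev: "eigenvalue (M * transpose_mat M) x"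
  shows "x \<ge> 0"
proof -
  obtain v where v: "v \<in> carrier_vec r" "v \<noteq> 0\<^sub>v r"
    and eq: "(M * transpose_mat M) *\<^sub>v v = x \<cdot>\<^sub>v v"
    using ev M by (auto simp: eigenvalue_def eigenvector_def)
  define u where "u = transpose_mat M *\<^sub>v v"
  have u: "u \<in> carrier_vec c"
    using M v by (simp add: u_def)
  have "x * (v \<bullet> v) = v \<bullet> ((M * transpose_mat M) *\<^sub>v v)"
    using v by (simp add: eq)
  also have "\<dots> = v \<bullet> (M *\<^sub>v u)"
    using M v by (simp add: u_def)
  also have "\<dots> = u \<bullet> u"
    using transpose_vec_mult_scalar[OF M u v(1)] by (simp add: u_def)
  also have "\<dots> \<ge> 0"
    by (auto simp: scalar_prod_def intro: sum_nonneg)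
  finally have "x * (v \<bullet> v) \<ge> 0" .
  moreover have "v \<bullet> v > 0"
  proof -
    obtain i where i: "i < r" "v $ i \<noteq> 0"
      using v by (metis carrier_vecD eq_vecI index_zero_vec)
    then have "0 < (v $ i) * (v $ i)" by (metis not_real_square_gt_zero)
    also have "\<dots> \<le> v \<bullet> v"
      using i v unfolding scalar_prod_def
      by (intro member_le_sum[where f = "\<lambda>i. (v $ i) * (v $ i)"]) auto
    finally show ?thesis .
  qed
  ultimately show ?thesis by (simp add: zero_le_mult_iff)
qed

text \<open>The real \<open>sqrt\<close> is an odd function here, negative on negative arguments, so
  the sign of the eigenvalues matters.\<close>

lemma singular_values_nonneg:
  assumes "M \<in> carrier_mat r c" and "x \<in># singular_values M"
  shows "x \<ge> 0"
proof -
  let ?G = "M * transpose_mat M"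
  have G: "?G \<in> carrier_mat r r" using assms(1) by simp
  \<comment> \<open>For a nonzero polynomial, the elements of \<open>proots\<close> are exactly its
    roots.\<close>
  have "char_poly ?G \<noteq> 0"
    using degree_monic_char_poly[OF G] by (metis coeff_0 zero_neq_one)
  with assms(2) obtain y where "x = sqrt y" "poly (char_poly ?G) y = 0"
    by (auto simp: singular_values_def)
  then show ?thesis
    using eigenvalue_gram_nonneg[OF assms(1)] eigenvalue_root_char_poly[OF G] by simp
qed

text \<open>The degree of the characteristic polynomial bounds the number of its roots.\<close>

lemma size_singular_values_le:
  assumes "M \<in> carrier_mat r c"
  shows "size (singular_values M) \<le> r"
  using size_proots_le[of "char_poly (M * transpose_mat M)"] assms
    degree_monic_char_poly[of "M * transpose_mat M" r]
  by (simp add: singular_values_def)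

text \<open>A scalar matrix is upper triangular, so its characteristic polynomial is the
  \<open>n\<close>-th power of \<open>[:- c, 1:]\<close>.\<close>

lemma singular_values_scalar_gram:
  assumes "M * transpose_mat M = c \<cdot>\<^sub>m 1\<^sub>m n"
  shows "singular_values M = replicate_mset n (sqrt c)"
proof -
  have "char_poly (c \<cdot>\<^sub>m 1\<^sub>m n) = (\<Prod>a\<leftarrow>diag_mat (c \<cdot>\<^sub>m 1\<^sub>m n). [:- a, 1:])"
    by (rule char_poly_upper_triangular[of _ n]) auto
  also have "diag_mat (c \<cdot>\<^sub>m 1\<^sub>m n) = replicate n c"
    by (auto simp: diag_mat_def intro: nth_equalityI)
  also have "(\<Prod>a\<leftarrow>replicate n c. [:- a, 1:]) = [:- c, 1:] ^ n"
    by simp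
  finally have "singular_values M = image_mset sqrt (repeat_mset n {#c#})"
    by (simp add: singular_values_def assms proots_power)
  also have "\<dots> = replicate_mset n (sqrt c)"
    by (induction n) auto
  finally show ?thesis .
qed

section \<open>Unfoldings\<close>

text \<open>Induction on the number of digits, splitting off the most significant one.\<close>

lemma digits_determine_mod:
  fixes c d n :: nat
  assumes "\<And>m. m < r \<Longrightarrow> c div n ^ m mod n = d div n ^ m mod n"
  shows "c mod n ^ r = d mod n ^ r"
  using assms
proof (induction r)
  case (Suc r)
  have "x mod n ^ Suc r = n ^ r * (x div n ^ r mod n) + x mod n ^ r" for x
    by (simp only: power_Suc2 mod_mult2_eq)
  with Suc show ?case by simp
qed simp

text \<open>A number below \<open>n ^ r\<close> is its own residue, hence determined by its digits.
  Surjectivity follows by counting: both sets have \<open>n ^ r\<close> elements.\<close>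

lemma bij_betw_digits:
  fixes n r :: nat
  shows "bij_betw (\<lambda>c. map (\<lambda>m. c div n ^ m mod n + 1) [0..<r])
           {..<n ^ r} {js. set js \<subseteq> {1..n} \<and> length js = r}"
    (is "bij_betw ?f ?A ?B")
proof -
  have inj: "inj_on ?f ?A"
  proof (rule inj_onI)
    fix c d assume "c \<in> ?A" "d \<in> ?A" and eq: "?f c = ?f d"
    then have "c mod n ^ r = d mod n ^ r"
      by (intro digits_determine_mod) auto
    with \<open>c \<in> ?A\<close> \<open>d \<in> ?A\<close> show "c = d" by simp
  qed
  have sub: "?f ` ?A \<subseteq> ?B"
  proof (rule image_subsetI)
    fix c assume c: "c \<in> ?A"
    have "c div n ^ m mod n + 1 \<in> {1..n}" if "m < r" for m
    proof -
      \<comment> \<open>For \<open>n = 0\<close> and \<open>r > 0\<close> there is no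
        \<open>c\<close> below \<open>n ^ r\<close>.\<close>
      from that c have "n > 0" by (cases n) (auto simp: power_0_left split: if_splits)
      then have "c div n ^ m mod n < n" by simp
      then show ?thesis by simp
    qed
    then show "?f c \<in> ?B" by auto
  qed
  have "card ?B = card (?f ` ?A)"
    unfolding card_image[OF inj] using card_lists_length_eq[of "{1..n}" r] by simp
  then have "?f ` ?A = ?B"
    using sub finite_lists_length_eq[of "{1..n}" r] by (intro card_subset_eq) auto
  with inj show ?thesis by (rule bij_betw_imageI)
qed

lemma mode_unfolding_carrier: "mode_unfolding k n T \<in> carrier_mat n (n ^ (k - 1))"
  by (simp add: mode_unfolding_def)

lemma index_gram_mode_unfolding:
  assumes "i < n" and "j < n"
  shows "(mode_unfolding k n T * transpose_mat (mode_unfolding k n T)) $$ (i, j) =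
    (\<Sum>js\<in>{js. set js \<subseteq> {1..n} \<and> length js = k - 1}. T (js @ [i + 1]) * T (js @ [j + 1]))"
proof -
  have "(mode_unfolding k n T * transpose_mat (mode_unfolding k n T)) $$ (i, j) =
    (\<Sum>c<n ^ (k - 1). T (map (\<lambda>m. c div n ^ m mod n + 1) [0..<k - 1] @ [i + 1]) *
                     T (map (\<lambda>m. c div n ^ m mod n + 1) [0..<k - 1] @ [j + 1]))"
    using assms by (simp add: mode_unfolding_def scalar_prod_def lessThan_atLeast0)
  also have "\<dots> = (\<Sum>js\<in>{js. set js \<subseteq> {1..n} \<and> length js = k - 1}.
                     T (js @ [i + 1]) * T (js @ [j + 1]))"
    by (rule sum.reindex_bij_betw[OF bij_betw_digits])
  finally show ?thesis .
qed

section \<open>The Laplacian of a 1-regular hypergraph\<close>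

lemma one_regular_unique_edge:
  assumes "regular_hypergraph n E 1" and "v \<in> {1..n}"
  shows "\<exists>!e. e \<in> E \<and> v \<in> e"
proof -
  have "card {e \<in> E. v \<in> e} = 1"
    using assms by (simp add: regular_hypergraph_def vertex_degree_def)
  then obtain e where "{e \<in> E. v \<in> e} = {e}" by (auto simp: card_1_singleton_iff)
  then show ?thesis by (intro ex1I[of _ e]) auto
qed

text \<open>Describes one row of the unfolding: \<open>e\<close> is the only hyperedge through
  \<open>v\<close>, so a tuple completed by \<open>v\<close> gives a hyperedge exactly when it
  orders \<open>e - {v}\<close>.\<close>

lemma laplacian_tensor_snoc:
  assumes "regular_hypergraph n E 1" and v: "v \<in> {1..n}"
    and "k \<ge> 3" and js: "length js = k - 1" and e: "e \<in> E" "v \<in> e"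
  shows "laplacian_tensor k E (js @ [v]) =
    of_bool (js = replicate (k - 1) v) -
    of_bool (js \<in> permutations_of_set (e - {v})) / fact (k - 1)"
proof -
  have uniq: "e' = e" if "e' \<in> E" "v \<in> e'" for e'
    using one_regular_unique_edge[OF assms(1) v] e that by auto
  \<comment> \<open>\<open>degree_tensor\<close> reads the vertex from the head of the list, whereas
    the row index \<open>v\<close> stands last.\<close>
  have const: "js @ [v] = replicate k (hd (js @ [v])) \<longleftrightarrow> js = replicate (k - 1) v"
  proof
    assume *: "js @ [v] = replicate k (hd (js @ [v]))"
    then have "\<forall>x\<in>set (js @ [v]). x = hd (js @ [v])"
      by (metis in_set_replicate)
    then have "\<forall>x\<in>set js. x = v" by (simp only: set_append) auto
    then show "js = replicate (k - 1) v"
      using js by (metis replicate_length_same)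
  next
    assume *: "js = replicate (k - 1) v"
    define k' where "k' = k - 2"
    then have k: "k = Suc (Suc k')" using \<open>k \<ge> 3\<close> by arith
    have "js @ [v] = replicate k v"
      by (simp add: * k replicate_append_same)
    then show "js @ [v] = replicate k (hd (js @ [v]))"
      by (simp add: k)
  qed
  have "hd (js @ [v]) = v" if "js = replicate (k - 1) v"
    using that \<open>k \<ge> 3\<close> by (cases js) auto
  moreover have "vertex_degree E v = 1"
    using assms(1) v by (simp add: regular_hypergraph_def)
  ultimately have "degree_tensor k E (js @ [v]) = of_bool (js = replicate (k - 1) v)"
    unfolding degree_tensor_def const by simp
  moreover have "distinct (js @ [v]) \<and> set (js @ [v]) \<in> E \<longleftrightarrow>
      js \<in> permutations_of_set (e - {v})"
  proof
    assume *: "distinct (js @ [v]) \<and> set (js @ [v]) \<in> E"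
    then have "set (js @ [v]) = e" by (intro uniq) auto
    with * show "js \<in> permutations_of_set (e - {v})"
      by (auto simp: permutations_of_set_def)
  next
    assume "js \<in> permutations_of_set (e - {v})"
    then have "set js = e - {v}" "distinct js"
      by (auto simp: permutations_of_set_def)
    with e show "distinct (js @ [v]) \<and> set (js @ [v]) \<in> E"
      by (simp add: insert_absorb)
  qed
  then have "adjacency_tensor k E (js @ [v]) =
      of_bool (js \<in> permutations_of_set (e - {v})) / fact (k - 1)"
    unfolding adjacency_tensor_def by simp
  ultimately show ?thesis by (simp add: laplacian_tensor_def)
qed

text \<open>Separates diagonal from adjacency entries, with \<open>r = k - 1\<close>. For
  \<open>k = 2\<close> this fails: the constant tuple of one row is an ordering in another.\<close>

lemma replicate_notin_permutations_of_set:
  assumes "r \<ge> 2"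
  shows "replicate r x \<notin> permutations_of_set A"
proof -
  define r' where "r' = r - 2"
  then have "r = Suc (Suc r')" using assms by arith
  then show ?thesis by (simp add: permutations_of_set_def)
qed

lemma laplacian_gram_one_regular:
  assumes "k \<ge> 3" and uni: "uniform_hypergraph k n E" and reg: "regular_hypergraph n E 1"
  defines "M \<equiv> mode_unfolding k n (laplacian_tensor k E)"
  shows "M * transpose_mat M = (1 + 1 / fact (k - 1)) \<cdot>\<^sub>m 1\<^sub>m n"
proof (rule eq_matI)
  let ?L = "laplacian_tensor k E"
  let ?J = "{js. set js \<subseteq> {1..n} \<and> length js = k - 1}"
  fix i j assume "i < dim_row ((1 + 1 / fact (k - 1)) \<cdot>\<^sub>m 1\<^sub>m n :: real mat)"
    and "j < dim_col ((1 + 1 / fact (k - 1)) \<cdot>\<^sub>m 1\<^sub>m n :: real mat)"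
  then have ij: "i < n" "j < n" by simp_all
  then have verts: "i + 1 \<in> {1..n}" "j + 1 \<in> {1..n}" by auto
  obtain e where e: "e \<in> E" "i + 1 \<in> e"
    using one_regular_unique_edge[OF reg verts(1)] by blast
  obtain f where f: "f \<in> E" "j + 1 \<in> f"
    using one_regular_unique_edge[OF reg verts(2)] by blast
  have edge: "e \<subseteq> {1..n}" "card e = k"
    using uni e by (auto simp: uniform_hypergraph_def)
  then have fin: "finite e" by (auto intro: finite_subset)
  have card_link: "card (e - {i + 1}) = k - 1"
    using edge e fin by simp
  have finJ: "finite ?J"
    by (rule finite_lists_length_eq) simp
  have k: "k - 1 \<ge> 2" using \<open>k \<ge> 3\<close> by simp
  have "(M * transpose_mat M) $$ (i, j) = (\<Sum>js\<in>?J. ?L (js @ [i + 1]) * ?L (js @ [j + 1]))"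
    unfolding M_def by (rule index_gram_mode_unfolding[OF ij])
  also have "\<dots> = (if i = j then 1 + 1 / fact (k - 1) else 0)"
  proof (cases "i = j")
    case True
    let ?P = "permutations_of_set (e - {i + 1})"
    have PJ: "?P \<subseteq> ?J"
      using edge card_link by (auto simp: permutations_of_set_def distinct_card[symmetric])
    \<comment> \<open>The two indicators are never both 1, so squaring their combination leaves no
      cross term.\<close>
    have "(\<Sum>js\<in>?J. ?L (js @ [i + 1]) * ?L (js @ [j + 1])) =
        (\<Sum>js\<in>?J. of_bool (js = replicate (k - 1) (i + 1)) +
                 of_bool (js \<in> ?P) / (fact (k - 1))\<^sup>2)"
    proof (rule sum.cong[OF refl])
      fix js assume "js \<in> ?J"
      then have len: "length js = k - 1" by simp
      show "?L (js @ [i + 1]) * ?L (js @ [j + 1]) =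
          of_bool (js = replicate (k - 1) (i + 1)) + of_bool (js \<in> ?P) / (fact (k - 1))\<^sup>2"
        using replicate_notin_permutations_of_set[OF k, of "i + 1" "e - {i + 1}"]
        unfolding True[symmetric] laplacian_tensor_snoc[OF reg verts(1) \<open>k \<ge> 3\<close> len e]
        by (auto simp: power2_eq_square)
    qed
    also have "\<dots> = (\<Sum>js\<in>?J. of_bool (js = replicate (k - 1) (i + 1))) +
                   (\<Sum>js\<in>?J. of_bool (js \<in> ?P)) / (fact (k - 1))\<^sup>2"
      by (simp only: sum.distrib sum_divide_distrib)
    also have "(\<Sum>js\<in>?J. of_bool (js = replicate (k - 1) (i + 1))) =
        (\<Sum>js\<in>{replicate (k - 1) (i + 1)}. 1 :: real)"
      using finJ verts by (intro sum.mono_neutral_cong_right) auto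
    also have "(\<Sum>js\<in>?J. of_bool (js \<in> ?P)) = (\<Sum>js\<in>?P. 1 :: real)"
      using finJ PJ by (intro sum.mono_neutral_cong_right) auto
    \<comment> \<open>The \<open>(k-1)!\<close> orderings cancel one of the two factorials in the
      denominator.\<close>
    also have "(\<Sum>js\<in>?P. 1 :: real) = fact (k - 1)"
      using fin card_link by simp
    finally show ?thesis using True by (simp add: power2_eq_square)
  next
    case False
    \<comment> \<open>A common ordering forces equal links. These are nonempty, so \<open>e\<close>
      and \<open>f\<close> share a vertex and coincide by uniqueness; but removing different
      vertices from one hyperedge containing both gives different sets.\<close>
    have disj: "js \<notin> permutations_of_set (f - {j + 1})"
      if js: "js \<in> permutations_of_set (e - {i + 1})" for js
    proof
      assume js': "js \<in> permutations_of_set (f - {j + 1})"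
      from js js' have eq: "e - {i + 1} = f - {j + 1}"
        by (simp add: permutations_of_set_def)
      have "e - {i + 1} \<noteq> {}" using card_link k by (metis card.empty not_numeral_le_zero)
      then obtain u where "u \<in> e" "u \<in> f" using eq by blast
      then have "e = f"
        using one_regular_unique_edge[OF reg, of u] edge e f by blast
      with eq e f False show False by auto
    qed
    \<comment> \<open>Expanding the product pairs constant tuples and orderings of the two rows;
      each of the four pairings is excluded.\<close>
    have "?L (js @ [i + 1]) * ?L (js @ [j + 1]) = 0" if "js \<in> ?J" for js
    proof -
      have len: "length js = k - 1" using that by simp
      have "replicate (k - 1) (i + 1) \<noteq> replicate (k - 1) (j + 1)"
        using False k by simp
      then show ?thesis
        using disj[of js]
          replicate_notin_permutations_of_set[OF k, of "i + 1" "f - {j + 1}"]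
          replicate_notin_permutations_of_set[OF k, of "j + 1" "e - {i + 1}"]
        unfolding laplacian_tensor_snoc[OF reg verts(1) \<open>k \<ge> 3\<close> len e]
          laplacian_tensor_snoc[OF reg verts(2) \<open>k \<ge> 3\<close> len f]
        by auto
    qed
    then have "(\<Sum>js\<in>?J. ?L (js @ [i + 1]) * ?L (js @ [j + 1])) = 0"
      by (rule sum.neutral[OF ballI])
    with False show ?thesis by simp
  qed
  finally show "(M * transpose_mat M) $$ (i, j) = ((1 + 1 / fact (k - 1)) \<cdot>\<^sub>m 1\<^sub>m n) $$ (i, j)"
    using ij by simp
qed (simp_all add: M_def mode_unfolding_def)

theorem proposition2:
  fixes k n :: nat and E :: "nat set set"
  assumes "k \<ge> 3" and "n \<ge> 1"
    and "uniform_hypergraph k n E" and "E \<noteq> {}"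
  shows "tensor_entropy k n E \<le> ln (real n) \<and>
         (regular_hypergraph n E 1 \<longrightarrow> tensor_entropy k n E = ln (real n))"
proof (intro conjI impI)
  have n: "n > 0" using assms by simp
  show "tensor_entropy k n E \<le> ln (real n)"
    unfolding tensor_entropy_def Let_def mode_singular_values_def
    using singular_values_nonneg[OF mode_unfolding_carrier]
      size_singular_values_le[OF mode_unfolding_carrier] n
    by (rule sum_mset_entropy_le)
  assume "regular_hypergraph n E 1"
  then have "mode_singular_values k n (laplacian_tensor k E) =
      replicate_mset n (sqrt (1 + 1 / fact (k - 1)))"
    unfolding mode_singular_values_def
    using assms by (intro singular_values_scalar_gram laplacian_gram_one_regular)
  \<comment> \<open>A nonzero common value makes the normalised singular values uniform, each
    \<open>1 / n\<close>.\<close>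
  moreover have "sqrt (1 + 1 / fact (k - 1)) \<noteq> (0 :: real)"
    by (simp add: add_pos_pos less_imp_neq[symmetric])
  ultimately show "tensor_entropy k n E = ln (real n)"
    unfolding tensor_entropy_def Let_def
    using sum_mset_entropy_replicate[OF _ n] by simp
qed

end
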